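(* For each $n\ge1$, $$\sum_{\pi\in\mathfrak S_n}(-1)^{\mathrm{exc}(\pi)}=\sum_{\pi\in\mathfrak S_n}(-1)^{\mathrm{exc}_P(\pi)}\quad\text{and}\quad \sum_{\pi\in\mathfrak D_n}(-1)^{\mathrm{exc}(\pi)}=\sum_{\pi\in\mathfrak D_n}(-1)^{\mathrm{exc}_P(\pi)}.$$
   Context: $\mathfrak S_n$ is the set of permutations of $[n]=\{1,\dots,n\}$ and $\mathfrak D_n=\{\pi\in\mathfrak S_n:\pi(i)\ne i\ \forall i\}$ is the set of derangements. $\mathrm{exc}(\pi)=\#\{i\in[n]:\pi(i)>i\}$. An index $i\in[n]$ is an excedance of type $P$ of $\pi$ if either $\pi(i)>i$ and $\pi(i)-i$ is odd, or $\pi(i)<i$ and $\pi(i)-i$ is even; $\mathrm{exc}_P(\pi)$ is the number of such indices. *)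

theory Defs
  imports Complex_Main "HOL-Combinatorics.Permutations"
begin

definition perms :: "nat \<Rightarrow> (nat \<Rightarrow> nat) set" where
  "perms n = {\<pi>. \<pi> permutes {1..n}}"

definition derangements :: "nat \<Rightarrow> (nat \<Rightarrow> nat) set" where
  "derangements n = {\<pi> \<in> perms n. \<forall>i\<in>{1..n}. \<pi> i \<noteq> i}"

definition exc :: "nat \<Rightarrow> (nat \<Rightarrow> nat) \<Rightarrow> nat" where
  "exc n \<pi> = card {i \<in> {1..n}. \<pi> i > i}"

(* The difference is taken in int because subtraction on nat truncates. *)
definition type_P_excedance :: "(nat \<Rightarrow> nat) \<Rightarrow> nat \<Rightarrow> bool" where
  "type_P_excedance \<pi> i \<longleftrightarrow>
     (\<pi> i > i \<and> odd (int (\<pi> i) - int i)) \<or> (\<pi> i < i \<and> even (int (\<pi> i) - int i))"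

definition exc_P :: "nat \<Rightarrow> (nat \<Rightarrow> nat) \<Rightarrow> nat" where
  "exc_P n \<pi> = card {i \<in> {1..n}. type_P_excedance \<pi> i}"

end

theory Submission
  imports Defs
begin

text \<open>For a permutation, the numbers \<open>\<pi> i - i\<close> sum to zero, so twisting the sign attached to each
  index by \<open>(-1)^(\<pi> i - i)\<close> does not change the overall sign. The twist turns excedances of type
  \<open>P\<close> into the indices with \<open>\<pi> i < i\<close>, and these correspond to the excedances of the inverse
  permutation.\<close>

lemma minus_one_power_card_filter:
  assumes "finite A"
  shows "(-1::'a::comm_ring_1) ^ card {i \<in> A. P i} = (\<Prod>i\<in>A. if P i then -1 else 1)"
  by (simp add: prod.inter_filter[OF assms, symmetric])

text \<open>Reindexing along \<open>\<pi>\<close> replaces each \<open>\<pi> i\<close> by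
  \<open>i\<close>, leaving squares of signs. The sum \<open>\<pi> i + i\<close> has the parity of
  the difference and avoids truncated subtraction.\<close>

lemma prod_minus_one_power_permutes:
  assumes "\<pi> permutes A"
  shows "(\<Prod>i\<in>A. (-1::'a::comm_ring_1) ^ (\<pi> i + i)) = 1"
proof -
  have "(\<Prod>i\<in>A. (-1::'a) ^ \<pi> i) = (\<Prod>i\<in>A. (-1) ^ i)"
    using assms prod.permute[of \<pi> A "\<lambda>i. (-1::'a) ^ i"] by (simp add: o_def)
  then have "(\<Prod>i\<in>A. (-1::'a) ^ (\<pi> i + i)) = (\<Prod>i\<in>A. (-1) ^ i * (-1) ^ i)"
    by (simp only: power_add prod.distrib)
  also have "\<dots> = 1"
    by (rule prod.neutral) (simp flip: power_mult_distrib)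
  finally show ?thesis .
qed

text \<open>If the difference is even, type \<open>P\<close> means a drop
  \<open>\<pi> i < i\<close>. If it is odd, \<open>i\<close> is not fixed and type \<open>P\<close>
  is the complement of a drop, so the sign flips.\<close>

lemma sign_type_P_excedance:
  "(if type_P_excedance \<pi> i then -1 else 1 :: 'a::comm_ring_1) =
     (-1) ^ (\<pi> i + i) * (if \<pi> i < i then -1 else 1)"
  by (cases "even (\<pi> i + i)"; cases "\<pi> i" i rule: linorder_cases)
    (auto simp: type_P_excedance_def minus_one_power_iff)

text \<open>A drop at \<open>i\<close> is an excedance of \<open>inv \<pi>\<close> at the value
  \<open>\<pi> i\<close>.\<close>

lemma card_drops_eq_exc_inv:
  assumes "\<pi> permutes {1..n}"
  shows "card {i \<in> {1..n}. \<pi> i < i} = exc n (inv \<pi>)"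
proof -
  have "bij_betw \<pi> {i \<in> {1..n}. \<pi> i < i} {j \<in> {1..n}. j < inv \<pi> j}"
    by (rule bij_betw_byWitness[where f' = "inv \<pi>"])
      (use permutes_inverses[OF assms] permutes_in_image[OF assms]
        permutes_in_image[OF permutes_inv[OF assms]] in auto)
  then show ?thesis
    by (simp add: exc_def bij_betw_same_card)
qed

lemma minus_one_power_exc_P:
  assumes "\<pi> permutes {1..n}"
  shows "(-1::'a::comm_ring_1) ^ exc_P n \<pi> = (-1) ^ exc n (inv \<pi>)"
  \<comment> \<open>Counting drops of \<open>\<pi>\<close> instead of excedances of
    \<open>inv \<pi>\<close> lets both sides be compared index by index.\<close>
  unfolding exc_P_def card_drops_eq_exc_inv[OF assms, symmetric]
  by (simp only: minus_one_power_card_filter[OF finite_atLeastAtMost] sign_type_P_excedance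
      prod.distrib prod_minus_one_power_permutes[OF assms] mult_1_left)

text \<open>Inversion is an involution of \<open>S\<close> carrying one summand to the other.
  Closure under inversion is all that is asked of a set of permutations, so derangements are covered
  too.\<close>

lemma sum_exc_eq_sum_exc_P:
  assumes perm: "\<And>\<pi>. \<pi> \<in> S \<Longrightarrow> \<pi> permutes {1..n}"
    and inv: "\<And>\<pi>. \<pi> \<in> S \<Longrightarrow> inv \<pi> \<in> S"
  shows "(\<Sum>\<pi>\<in>S. (-1::'a::comm_ring_1) ^ exc n \<pi>) = (\<Sum>\<pi>\<in>S. (-1) ^ exc_P n \<pi>)"
  by (rule sum.reindex_bij_witness[where i = inv and j = inv])
    (use assms in \<open>auto simp: minus_one_power_exc_P permutes_inv_inv[OF perm]\<close>)

lemma inv_in_derangements: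
  assumes "\<pi> \<in> derangements n"
  shows "inv \<pi> \<in> derangements n"
proof -
  from assms have \<pi>: "\<pi> permutes {1..n}" and "\<forall>i\<in>{1..n}. \<pi> i \<noteq> i"
    by (auto simp: derangements_def perms_def)
  then show ?thesis
    using permutes_inv_eq[OF \<pi>] by (auto simp: derangements_def perms_def permutes_inv)
qed

theorem theorem3p1:
  fixes n :: nat
  assumes "n \<ge> 1"
  shows "(\<Sum>\<pi>\<in>perms n. (-1::int) ^ exc n \<pi>) = (\<Sum>\<pi>\<in>perms n. (-1) ^ exc_P n \<pi>)
    \<and> (\<Sum>\<pi>\<in>derangements n. (-1::int) ^ exc n \<pi>) = (\<Sum>\<pi>\<in>derangements n. (-1) ^ exc_P n \<pi>)"
proof
  show "(\<Sum>\<pi>\<in>perms n. (-1::int) ^ exc n \<pi>) = (\<Sum>\<pi>\<in>perms n. (-1) ^ exc_P n \<pi>)"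
    by (rule sum_exc_eq_sum_exc_P) (auto simp: perms_def permutes_inv)
  show "(\<Sum>\<pi>\<in>derangements n. (-1::int) ^ exc n \<pi>) = (\<Sum>\<pi>\<in>derangements n. (-1) ^ exc_P n \<pi>)"
    by (rule sum_exc_eq_sum_exc_P) (auto simp: inv_in_derangements, simp add: derangements_def perms_def)
qed

end
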